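(* Consider a causal model over a set $S$ of observed random variables, let $X,Y,Z\subseteq S$ be pairwise disjoint with $X,Y$ non-empty, and suppose the affects relation $X\vDash Y\mid \mathrm{do}(Z)$ holds. Then for every $i\in\{1,2,3\}$: if $X\vDash Y\mid\mathrm{do}(Z)$ is clustered in the $i$-th argument (Clus$_i$), then it is irreducible in the $i$-th argument (Irred$_i$).
   Context: **Causal model.** A causal structure is a directed graph $\mathcal G$ (cycles allowed) whose nodes are observed or unobserved; the finitely many observed nodes are random variables. For sets of nodes, $AB:=A\cup B$. For a set $X$ of observed nodes, $\mathcal G_{\mathrm{do}(X)}$ is $\mathcal G$ with all edges into nodes of $X$ removed. A causal model consists of $\mathcal G$ with a joint distribution $P_{\mathcal G}$ of the observed nodes (satisfying the d-separation property: d-separation in the graph implies conditional independence), together with, for every set $X$ of observed nodes, a post-intervention distribution $P_{\mathcal G_{\mathrm{do}(X)}}$ of the observed nodes, satisfying the d-separation property relative to $\mathcal G_{\mathrm{do}(X)}$ ($\mathcal G_{\mathrm{do}(\emptyset)}=\mathcal G$). Conditional distributions given values of the intervened nodes are taken as specified for all such values. $(A\perp\!\!\!\perp B\mid C)_{\mathcal G'}$ means $P_{\mathcal G'}(AB|C)=P_{\mathcal G'}(A|C)P_{\mathcal G'}(B|C)$. **Affects relations.** For pairwise disjoint sets $X,Y,Z,W$ of observed nodes, $X,Y$ non-empty, $X\vDash Y\mid\mathrm{do}(Z),W$ holds iff there are values $x,z,w$ with $P_{\mathcal G_{\mathrm{do}(XZ)}}(Y|X=x,Z=z,W=w)\neq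 P_{\mathcal G_{\mathrm{do}(Z)}}(Y|Z=z,W=w)$. $X\vDash Y\mid\mathrm{do}(Z)$ is the case $W=\emptyset$. $\not\vDash$ is the negation. **Reducibility** of $X\vDash Y\mid\mathrm{do}(Z)$ (Irred$_i$ means not Red$_i$): - Red$_1$: there is a non-empty $s_X\subsetneq X$ with $s_X\not\vDash Y\mid\mathrm{do}(\tilde s_XZ)$, where $\tilde s_X=X\setminus s_X$. - Red$_2$: there is a non-empty $s_Y\subsetneq Y$ such that, with $\tilde s_Y=Y\setminus s_Y$, both $X\not\vDash s_Y\mid\mathrm{do}(Z),\tilde s_Y$, and [$(s_Y\perp\!\!\!\perp\tilde s_Y\mid XZ)_{\mathcal G_{\mathrm{do}(XZ)}}$ or $(s_Y\perp\!\!\!\perp\tilde s_Y\mid Z)_{\mathcal G_{\mathrm{do}(Z)}}$]. - Red$_3$: there is a non-empty $s_Z\subseteq Z$ such that, with $\tilde s_Z=Z\setminus s_Z$, both $s_Z\not\vDash Y\mid\mathrm{do}(X\tilde s_Z)$ and $s_Z\not\vDash Y\mid\mathrm{do}(\tilde s_Z)$. **Clustering** of $X\vDash Y\mid\mathrm{do}(Z)$: - Clus$_1$: $|X|\ge2$ and no (non-empty) $s_X\subsetneq X$ satisfies $s_X\vDash Y\mid\mathrm{do}(Z)$. - Clus$_2$: $|Y|\ge2$ and no (non-empty) $s_Y\subsetneq Y$ satisfies $X\vDash s_Y\mid\mathrm{do}(Z)$. - Clus$_3$: $|Z|\ge1$ and no $s_Z\subsetneq Z$ (possibly empty) satisfies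 $X\vDash Y\mid\mathrm{do}(s_Z)$. *)

theory Defs
  imports "HOL-Probability.Probability"
begin

(* A path is a list p of distinct nodes together with a list d of edge orientations: d ! i says
   whether the i-th step uses the edge p_i \<rightarrow> p_{i+1} (True) or p_{i+1} \<rightarrow> p_i (False). In a cyclic graph
   both edges may exist, and they give two different paths. *)
definition is_path :: "('n \<times> 'n) set \<Rightarrow> 'n list \<Rightarrow> bool list \<Rightarrow> bool" where
  "is_path E p d \<longleftrightarrow> length p = Suc (length d) \<and> distinct p \<and>
     (\<forall>i<length d. if d ! i then (p ! i, p ! Suc i) \<in> E else (p ! Suc i, p ! i) \<in> E)"

(* A collider blocks unless it or one of its descendants is in C; any other inner node blocks
   iff it is in C. *)
definition blocked :: "('n \<times> 'n) set \<Rightarrow> 'n set \<Rightarrow> 'n list \<Rightarrow> bool list \<Rightarrow> bool" where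
  "blocked E C p d \<longleftrightarrow> (\<exists>i. 0 < i \<and> i < length d \<and>
     (if d ! (i - 1) \<and> \<not> d ! i then \<forall>c\<in>C. (p ! i, c) \<notin> E\<^sup>* else p ! i \<in> C))"

definition d_separated :: "('n \<times> 'n) set \<Rightarrow> 'n set \<Rightarrow> 'n set \<Rightarrow> 'n set \<Rightarrow> bool" where
  "d_separated E A B C \<longleftrightarrow>
     (\<forall>p d. is_path E p d \<and> hd p \<in> A \<and> last p \<in> B \<longrightarrow> blocked E C p d)"

definition do_graph :: "('n \<times> 'n) set \<Rightarrow> 'n set \<Rightarrow> ('n \<times> 'n) set" where
  "do_graph E X = {(a, b) \<in> E. b \<notin> X}"


(* val_space v is the measurable space of values of the observed node v. A value of a set X of nodes
   is a point of PiM X val_space. joint X is the distribution of all observed nodes in the graph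
   after do(X) (joint {} is the distribution without intervention), and do_cond X x is its
   conditional distribution given X = x, specified for every value x of X, also for those of
   joint X-probability zero. *)
record ('n, 'a) cmodel =
  nodes :: "'n set"
  observed :: "'n set"
  edges :: "('n \<times> 'n) set"
  val_space :: "'n \<Rightarrow> 'a measure"
  joint :: "'n set \<Rightarrow> ('n \<Rightarrow> 'a) measure"
  do_cond :: "'n set \<Rightarrow> ('n \<Rightarrow> 'a) \<Rightarrow> ('n \<Rightarrow> 'a) measure"

definition vals :: "('n, 'a) cmodel \<Rightarrow> 'n set \<Rightarrow> ('n \<Rightarrow> 'a) measure" where
  "vals Q X = PiM X (val_space Q)"

definition event :: "('n \<Rightarrow> 'a) measure \<Rightarrow> 'n set \<Rightarrow> ('n \<Rightarrow> 'a) set \<Rightarrow> ('n \<Rightarrow> 'a) set" where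
  "event N A B = {\<omega> \<in> space N. restrict \<omega> A \<in> B}"

(* The sigma-algebra generated by the variables in C. *)
definition gen_by :: "('n, 'a) cmodel \<Rightarrow> ('n \<Rightarrow> 'a) measure \<Rightarrow> 'n set \<Rightarrow> ('n \<Rightarrow> 'a) measure" where
  "gen_by Q N C = vimage_algebra (space N) (\<lambda>\<omega>. restrict \<omega> C) (vals Q C)"

(* P(AB|C) = P(A|C) P(B|C) for the distribution N. *)
definition cond_indep ::
    "('n, 'a) cmodel \<Rightarrow> ('n \<Rightarrow> 'a) measure \<Rightarrow> 'n set \<Rightarrow> 'n set \<Rightarrow> 'n set \<Rightarrow> bool" where
  "cond_indep Q N A B C \<longleftrightarrow> (\<forall>a\<in>sets (vals Q A). \<forall>b\<in>sets (vals Q B). AE \<omega> in N.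
     real_cond_exp N (gen_by Q N C) (indicator (event N A a \<inter> event N B b)) \<omega> =
     real_cond_exp N (gen_by Q N C) (indicator (event N A a)) \<omega> *
     real_cond_exp N (gen_by Q N C) (indicator (event N B b)) \<omega>)"

(* Conditional independence of A and B given C after do(X). If the intervened nodes X are among the
   conditioned ones, the conditional distributions are specified for every value of X, and the
   factorisation is required for every such value. *)
definition do_indep ::
    "('n, 'a) cmodel \<Rightarrow> 'n set \<Rightarrow> 'n set \<Rightarrow> 'n set \<Rightarrow> 'n set \<Rightarrow> bool" where
  "do_indep Q X A B C \<longleftrightarrow>
     (if X \<subseteq> C then \<forall>x\<in>space (vals Q X). cond_indep Q (do_cond Q X x) A B C
      else cond_indep Q (joint Q X) A B C)"

locale causal_model =
  fixes Q :: "('n, 'a) cmodel"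
  assumes finite_observed: "finite (observed Q)"
    and observed_nodes: "observed Q \<subseteq> nodes Q"
    and edges_nodes: "edges Q \<subseteq> nodes Q \<times> nodes Q"
    and prob_joint: "X \<subseteq> observed Q \<Longrightarrow> joint Q X \<in> space (prob_algebra (vals Q (observed Q)))"
    and kernel_do_cond:
      "X \<subseteq> observed Q \<Longrightarrow> do_cond Q X \<in> vals Q X \<rightarrow>\<^sub>M prob_algebra (vals Q (observed Q))"
    and do_cond_fixes: "X \<subseteq> observed Q \<Longrightarrow> x \<in> space (vals Q X) \<Longrightarrow>
      distr (do_cond Q X x) (vals Q X) (\<lambda>\<omega>. restrict \<omega> X) = return (vals Q X) x"
    and do_cond_joint: "X \<subseteq> observed Q \<Longrightarrow>
      joint Q X = distr (joint Q X) (vals Q X) (\<lambda>\<omega>. restrict \<omega> X) \<bind> do_cond Q X"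
    and d_separation: "X \<subseteq> observed Q \<Longrightarrow>
      A \<subseteq> observed Q \<Longrightarrow> B \<subseteq> observed Q \<Longrightarrow> C \<subseteq> observed Q \<Longrightarrow>
      A \<inter> B = {} \<Longrightarrow> A \<inter> C = {} \<Longrightarrow> B \<inter> C = {} \<Longrightarrow>
      d_separated (do_graph (edges Q) X) A B C \<Longrightarrow> do_indep Q X A B C"


(* f is a version of the function w \<mapsto> P(Y \<in> B | W = w) for the distribution N. *)
definition is_cond_prob :: "('n, 'a) cmodel \<Rightarrow> ('n \<Rightarrow> 'a) measure \<Rightarrow> 'n set \<Rightarrow> ('n \<Rightarrow> 'a) set \<Rightarrow>
    'n set \<Rightarrow> (('n \<Rightarrow> 'a) \<Rightarrow> real) \<Rightarrow> bool" where
  "is_cond_prob Q N Y B W f \<longleftrightarrow> f \<in> borel_measurable (vals Q W) \<and>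
     (AE \<omega> in N. real_cond_exp N (gen_by Q N W) (indicator (event N Y B)) \<omega> = f (restrict \<omega> W))"

(* X affects Y given do(Z), W: v is a joint value of X and Z, and two distributions of Y differ iff they
   differ on some event B. Conditional probabilities given W = w are determined only up to null
   sets, so they count as different if every choice of versions differs at some w.
   For discrete W this means: different at some w which has positive probability under both
   distributions (affects_discrete below); for empty W it means different distributions of Y
   (affects_no_cond below). *)
definition affects ::
    "('n, 'a) cmodel \<Rightarrow> 'n set \<Rightarrow> 'n set \<Rightarrow> 'n set \<Rightarrow> 'n set \<Rightarrow> bool" where
  "affects Q X Y Z W \<longleftrightarrow> (\<exists>v\<in>space (vals Q (X \<union> Z)). \<exists>B\<in>sets (vals Q Y). \<forall>f g.
     is_cond_prob Q (do_cond Q (X \<union> Z) v) Y B W f \<longrightarrow>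
     is_cond_prob Q (do_cond Q Z (restrict v Z)) Y B W g \<longrightarrow>
     (\<exists>w\<in>space (vals Q W). f w \<noteq> g w))"

lemma measurable_restrict_vals: assumes "sets N = sets (vals Q S)" "C \<subseteq> S"
  shows "(\<lambda>\<omega>. restrict \<omega> C) \<in> N \<rightarrow>\<^sub>M vals Q C"
  using assms measurable_restrict_subset[of C S "val_space Q"]
  unfolding vals_def by (simp cong: measurable_cong_sets)

lemma event_sets: assumes "sets N = sets (vals Q S)" "C \<subseteq> S" "A \<in> sets (vals Q C)"
  shows "event N C A \<in> sets N"
proof -
  have "event N C A = (\<lambda>\<omega>. restrict \<omega> C) -` A \<inter> space N" by (auto simp: event_def)
  then show ?thesis using measurable_sets[OF measurable_restrict_vals[OF assms(1,2)] assms(3)] by simp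
qed

lemma subalgebra_gen_by: assumes "sets N = sets (vals Q S)" "C \<subseteq> S"
  shows "subalgebra N (gen_by Q N C)"
proof -
  have "(\<lambda>\<omega>. restrict \<omega> C) -` A \<inter> space N \<in> sets N" if "A \<in> sets (vals Q C)" for A
    using measurable_sets[OF measurable_restrict_vals[OF assms] that] .
  moreover have "(\<lambda>\<omega>. restrict \<omega> C) \<in> space N \<rightarrow> space (vals Q C)"
    using measurable_space[OF measurable_restrict_vals[OF assms]] by auto
  ultimately show ?thesis
    unfolding subalgebra_def gen_by_def by (auto simp: sets_vimage_algebra2)
qed

lemma event_gen_by: assumes "A \<in> sets (vals Q C)"
  shows "event N C A \<in> sets (gen_by Q N C)"
proof -
  have "event N C A = (\<lambda>\<omega>. restrict \<omega> C) -` A \<inter> space N" by (auto simp: event_def)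
  then show ?thesis using assms by (simp add: gen_by_def in_vimage_algebra)
qed

lemma cond_exp_event:
  assumes "prob_space N" and N: "sets N = sets (vals Q S)" and "W \<subseteq> S" "Y \<subseteq> S"
    and B: "B \<in> sets (vals Q Y)" and A: "A \<in> sets (vals Q W)"
  shows "measure N (event N Y B \<inter> event N W A) =
    (\<integral>\<omega>\<in>event N W A. real_cond_exp N (gen_by Q N W) (indicator (event N Y B)) \<omega> \<partial>N)"
proof -
  interpret prob_space N by fact
  interpret finite_measure_subalgebra N "gen_by Q N W"
    using subalgebra_gen_by[OF N \<open>W \<subseteq> S\<close>] by unfold_locales
  have [measurable]: "event N Y B \<in> sets N" "event N W A \<in> sets N" using event_sets[OF N] assms by auto
  have "measure N (event N Y B \<inter> event N W A) = (\<integral>\<omega>\<in>event N W A. indicator (event N Y B) \<omega> \<partial>N)"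
    unfolding set_lebesgue_integral_def
    by (simp add: indicator_inter_arith[symmetric] Int_commute)
  also have "\<dots> = (\<integral>\<omega>\<in>event N W A. real_cond_exp N (gen_by Q N W) (indicator (event N Y B)) \<omega> \<partial>N)"
    by (rule real_cond_exp_intA) (auto simp: event_gen_by A emeasure_eq_measure)
  finally show ?thesis .
qed

lemma is_cond_prob_discrete:
  assumes "prob_space N" and N: "sets N = sets (vals Q S)" and "W \<subseteq> S" "Y \<subseteq> S"
    and B: "B \<in> sets (vals Q Y)"
    and W: "countable (space (vals Q W))" "sets (vals Q W) = Pow (space (vals Q W))"
  shows "is_cond_prob Q N Y B W f \<longleftrightarrow> (\<forall>w\<in>space (vals Q W). measure N (event N W {w}) > 0 \<longrightarrow>
    f w = measure N (event N Y B \<inter> event N W {w}) / measure N (event N W {w}))"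
proof -
  interpret prob_space N by fact
  define r where "r = real_cond_exp N (gen_by Q N W) (indicator (event N Y B))"
  have r: "r \<in> borel_measurable (gen_by Q N W)" unfolding r_def by simp
  have spW: "restrict \<omega> W \<in> space (vals Q W)" if "\<omega> \<in> space N" for \<omega>
    using measurable_space[OF measurable_restrict_vals[OF N \<open>W \<subseteq> S\<close>] that] .
  have ev [measurable]: "event N W A \<in> sets N" if "A \<subseteq> space (vals Q W)" for A
    using event_sets[OF N \<open>W \<subseteq> S\<close>] that W by blast
  have const: "r \<omega> = r \<omega>'" if "\<omega> \<in> space N" "\<omega>' \<in> space N" "restrict \<omega> W = restrict \<omega>' W" for \<omega> \<omega>'
  proof -
    have "r -` {r \<omega>'} \<inter> space (gen_by Q N W) \<in> sets (gen_by Q N W)"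
      using r by (rule measurable_sets) simp
    then obtain A where "r -` {r \<omega>'} \<inter> space N = (\<lambda>\<omega>. restrict \<omega> W) -` A \<inter> space N"
      unfolding gen_by_def using spW by (auto simp: sets_vimage_algebra2)
    then show ?thesis using that by (metis (mono_tags, lifting) IntE IntI insertI1 singletonD vimageD vimageI2)
  qed
  have val: "r \<omega> = measure N (event N Y B \<inter> event N W {w}) / measure N (event N W {w})"
    if "\<omega> \<in> event N W {w}" "measure N (event N W {w}) > 0" "w \<in> space (vals Q W)" for \<omega> w
  proof -
    have "measure N (event N Y B \<inter> event N W {w}) = (\<integral>x\<in>event N W {w}. r x \<partial>N)"
      unfolding r_def by (rule cond_exp_event[OF assms(1-5)]) (use that W in auto)
    also have "\<dots> = (\<integral>x\<in>event N W {w}. r \<omega> \<partial>N)"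
      by (rule set_lebesgue_integral_cong) (use that const ev[of "{w}"] in \<open>auto simp: event_def\<close>)
    also have "\<dots> = r \<omega> * measure N (event N W {w})"
      using ev[of "{w}"] that unfolding set_lebesgue_integral_def by simp
    finally show ?thesis using that by simp
  qed
  have null: "AE \<omega> in N. measure N (event N W {restrict \<omega> W}) > 0"
  proof -
    have "AE \<omega> in N. \<forall>w\<in>space (vals Q W). \<not> (measure N (event N W {w}) = 0 \<and> \<omega> \<in> event N W {w})"
      unfolding AE_ball_countable[OF W(1)]
    proof
      fix w assume w: "w \<in> space (vals Q W)"
      show "AE \<omega> in N. \<not> (measure N (event N W {w}) = 0 \<and> \<omega> \<in> event N W {w})"
      proof (cases "measure N (event N W {w}) = 0")
        case True
        then have "event N W {w} \<in> null_sets N"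
          using ev[of "{w}"] w by (auto simp: null_sets_def emeasure_eq_measure)
        then show ?thesis by (auto dest: AE_not_in)
      qed auto
    qed
    then show ?thesis
    proof (rule AE_mp, intro AE_I2 impI)
      fix \<omega> assume *: "\<omega> \<in> space N" "\<forall>w\<in>space (vals Q W). \<not> (measure N (event N W {w}) = 0 \<and> \<omega> \<in> event N W {w})"
      have "\<omega> \<in> event N W {restrict \<omega> W}" using * by (simp add: event_def)
      then have "measure N (event N W {restrict \<omega> W}) \<noteq> 0" using * spW by blast
      then show "measure N (event N W {restrict \<omega> W}) > 0" by (simp add: zero_less_measure_iff)
    qed
  qed
  have meas: "f \<in> borel_measurable (vals Q W)"
    unfolding measurable_def using W by auto
  show ?thesis unfolding is_cond_prob_def r_def[symmetric]
  proof (safe intro!: meas)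
    fix w assume AE: "AE \<omega> in N. r \<omega> = f (restrict \<omega> W)" and w: "w \<in> space (vals Q W)" "0 < measure N (event N W {w})"
    have "\<exists>\<omega>\<in>event N W {w}. r \<omega> = f (restrict \<omega> W)"
    proof (rule ccontr)
      assume "\<not> ?thesis"
      then have "AE \<omega> in N. \<omega> \<notin> event N W {w}" using AE by (auto elim!: eventually_mono)
      then have "measure N (event N W {w}) = 0"
        using ev[of "{w}"] w by (simp add: AE_iff_measurable[OF _ refl] measure_def
          event_def Int_def conj_commute)
      then show False using w by simp
    qed
    then show "f w = measure N (event N Y B \<inter> event N W {w}) / measure N (event N W {w})"
      using val w by (force simp: event_def)
  next
    assume *: "\<forall>w\<in>space (vals Q W). 0 < measure N (event N W {w}) \<longrightarrow>
      f w = measure N (event N Y B \<inter> event N W {w}) / measure N (event N W {w})"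
    show "AE \<omega> in N. r \<omega> = f (restrict \<omega> W)"
      using null
    proof (rule AE_mp, intro AE_I2 impI)
      fix \<omega> assume "\<omega> \<in> space N" "measure N (event N W {restrict \<omega> W}) > 0"
      then show "r \<omega> = f (restrict \<omega> W)" using * spW val[of \<omega> "restrict \<omega> W"] by (simp add: event_def)
    qed
  qed
qed

context causal_model
begin

lemma do_cond_sets: assumes "X \<subseteq> observed Q" "x \<in> space (vals Q X)"
  shows "prob_space (do_cond Q X x)" "sets (do_cond Q X x) = sets (vals Q (observed Q))"
  using measurable_space[OF kernel_do_cond[OF assms(1)] assms(2)] by (auto simp: space_prob_algebra)

lemma restrict_vals: assumes "v \<in> space (vals Q X)" "Z \<subseteq> X"
  shows "restrict v Z \<in> space (vals Q Z)"
  using assms by (auto simp: vals_def space_PiM PiE_iff subset_iff)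

lemma affects_discrete:
  assumes "X \<subseteq> observed Q" "Y \<subseteq> observed Q" "Z \<subseteq> observed Q" "W \<subseteq> observed Q"
    and W: "countable (space (vals Q W))" "sets (vals Q W) = Pow (space (vals Q W))"
  shows "affects Q X Y Z W \<longleftrightarrow>
    (\<exists>v\<in>space (vals Q (X \<union> Z)). \<exists>B\<in>sets (vals Q Y). \<exists>w\<in>space (vals Q W).
      let M = do_cond Q (X \<union> Z) v; N = do_cond Q Z (restrict v Z) in
        measure M (event M W {w}) > 0 \<and> measure N (event N W {w}) > 0 \<and>
        measure M (event M Y B \<inter> event M W {w}) / measure M (event M W {w}) \<noteq>
        measure N (event N Y B \<inter> event N W {w}) / measure N (event N W {w}))"
  unfolding affects_def Let_def
proof (intro bex_cong refl, goal_cases)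
  case (1 v B)
  let ?M = "do_cond Q (X \<union> Z) v" and ?N = "do_cond Q Z (restrict v Z)"
  define m where "m w = measure ?M (event ?M Y B \<inter> event ?M W {w}) / measure ?M (event ?M W {w})" for w
  define n where "n w = measure ?N (event ?N Y B \<inter> event ?N W {w}) / measure ?N (event ?N W {w})" for w
  have XZ: "X \<union> Z \<subseteq> observed Q" using assms by auto
  have v: "restrict v Z \<in> space (vals Q Z)" using restrict_vals[OF 1(1)] by simp
  note M = is_cond_prob_discrete[OF do_cond_sets[OF XZ 1(1)] assms(4,2) 1(2) W, folded m_def]
  note N = is_cond_prob_discrete[OF do_cond_sets[OF assms(3) v] assms(4,2) 1(2) W, folded n_def]
  show ?case unfolding M N m_def[symmetric] n_def[symmetric]
  proof
    assume H: "\<forall>f g. (\<forall>w\<in>space (vals Q W). 0 < measure ?M (event ?M W {w}) \<longrightarrow> f w = m w) \<longrightarrow>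
       (\<forall>w\<in>space (vals Q W). 0 < measure ?N (event ?N W {w}) \<longrightarrow> g w = n w) \<longrightarrow>
       (\<exists>w\<in>space (vals Q W). f w \<noteq> g w)"
    let ?f = "\<lambda>w. if 0 < measure ?M (event ?M W {w}) then m w else n w"
    let ?g = "\<lambda>w. if 0 < measure ?N (event ?N W {w}) then n w else if 0 < measure ?M (event ?M W {w}) then m w else n w"
    have "\<exists>w\<in>space (vals Q W). ?f w \<noteq> ?g w" using H[rule_format, of ?f ?g] by simp
    then show "\<exists>w\<in>space (vals Q W). 0 < measure ?M (event ?M W {w}) \<and> 0 < measure ?N (event ?N W {w}) \<and> m w \<noteq> n w"
      by (auto split: if_splits)
  qed metis
qed

lemma affects_no_cond:
  assumes "X \<subseteq> observed Q" "Y \<subseteq> observed Q" "Z \<subseteq> observed Q"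
  shows "affects Q X Y Z {} \<longleftrightarrow>
    (\<exists>v\<in>space (vals Q (X \<union> Z)).
      distr (do_cond Q (X \<union> Z) v) (vals Q Y) (\<lambda>\<omega>. restrict \<omega> Y) \<noteq>
      distr (do_cond Q Z (restrict v Z)) (vals Q Y) (\<lambda>\<omega>. restrict \<omega> Y))"
proof -
  have sp: "space (vals Q {}) = {\<lambda>_. undefined}" by (simp add: vals_def space_PiM_empty)
  have W: "countable (space (vals Q {}))" "sets (vals Q {}) = Pow (space (vals Q {}))"
    by (auto simp: vals_def sets_PiM_empty space_PiM_empty Pow_insert)
  have XZ: "X \<union> Z \<subseteq> observed Q" using assms by auto
  show ?thesis unfolding affects_discrete[OF assms _ W, simplified] Let_def sp bex_simps
  proof (intro bex_cong refl, goal_cases)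
    case (1 v)
    have v: "restrict v Z \<in> space (vals Q Z)" using restrict_vals[OF 1] by simp
    let ?M = "do_cond Q (X \<union> Z) v" and ?N = "do_cond Q Z (restrict v Z)"
    note M = do_cond_sets[OF XZ 1] and N = do_cond_sets[OF assms(3) v]
    interpret M: prob_space ?M by (rule M)
    interpret N: prob_space ?N by (rule N)
    have eq: "emeasure (distr K (vals Q Y) (\<lambda>\<omega>. restrict \<omega> Y)) B = emeasure K (event K Y B)"
      if "B \<in> sets (vals Q Y)" "sets K = sets (vals Q (observed Q))" for B K
      using emeasure_distr[OF measurable_restrict_vals[OF that(2) assms(2)] that(1)]
      by (simp add: event_def vimage_def Int_def conj_commute)
    have "(distr ?M (vals Q Y) (\<lambda>\<omega>. restrict \<omega> Y) = distr ?N (vals Q Y) (\<lambda>\<omega>. restrict \<omega> Y)) \<longleftrightarrow>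
      (\<forall>B\<in>sets (vals Q Y). measure ?M (event ?M Y B) = measure ?N (event ?N Y B))"
    proof
      assume *: "distr ?M (vals Q Y) (\<lambda>\<omega>. restrict \<omega> Y) = distr ?N (vals Q Y) (\<lambda>\<omega>. restrict \<omega> Y)"
      show "\<forall>B\<in>sets (vals Q Y). measure ?M (event ?M Y B) = measure ?N (event ?N Y B)"
        using eq[OF _ M(2)] eq[OF _ N(2)] * by (auto simp: measure_def)
    next
      assume *: "\<forall>B\<in>sets (vals Q Y). measure ?M (event ?M Y B) = measure ?N (event ?N Y B)"
      show "distr ?M (vals Q Y) (\<lambda>\<omega>. restrict \<omega> Y) = distr ?N (vals Q Y) (\<lambda>\<omega>. restrict \<omega> Y)"
        by (rule measure_eqI) (use * eq[OF _ M(2)] eq[OF _ N(2)] in \<open>auto simp: M.emeasure_eq_measure N.emeasure_eq_measure\<close>)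
    qed
    moreover have "event ?M {} {\<lambda>_. undefined} = space ?M" "event ?N {} {\<lambda>_. undefined} = space ?N"
      "event ?M Y B \<inter> space ?M = event ?M Y B" "event ?N Y B \<inter> space ?N = event ?N Y B" for B
      by (auto simp: event_def restrict_def)
    ultimately show ?case by (simp add: M.prob_space N.prob_space)
  qed
qed

end


definition red1 :: "('n, 'a) cmodel \<Rightarrow> 'n set \<Rightarrow> 'n set \<Rightarrow> 'n set \<Rightarrow> bool" where
  "red1 Q X Y Z \<longleftrightarrow> (\<exists>s. s \<noteq> {} \<and> s \<subset> X \<and> \<not> affects Q s Y ((X - s) \<union> Z) {})"

definition red2 :: "('n, 'a) cmodel \<Rightarrow> 'n set \<Rightarrow> 'n set \<Rightarrow> 'n set \<Rightarrow> bool" where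
  "red2 Q X Y Z \<longleftrightarrow> (\<exists>s. s \<noteq> {} \<and> s \<subset> Y \<and> \<not> affects Q X s Z (Y - s) \<and>
     (do_indep Q (X \<union> Z) s (Y - s) (X \<union> Z) \<or> do_indep Q Z s (Y - s) Z))"

definition red3 :: "('n, 'a) cmodel \<Rightarrow> 'n set \<Rightarrow> 'n set \<Rightarrow> 'n set \<Rightarrow> bool" where
  "red3 Q X Y Z \<longleftrightarrow> (\<exists>s. s \<noteq> {} \<and> s \<subseteq> Z \<and>
     \<not> affects Q s Y (X \<union> (Z - s)) {} \<and> \<not> affects Q s Y (Z - s) {})"

definition clus1 :: "('n, 'a) cmodel \<Rightarrow> 'n set \<Rightarrow> 'n set \<Rightarrow> 'n set \<Rightarrow> bool" where
  "clus1 Q X Y Z \<longleftrightarrow> card X \<ge> 2 \<and> \<not> (\<exists>s. s \<noteq> {} \<and> s \<subset> X \<and> affects Q s Y Z {})"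

definition clus2 :: "('n, 'a) cmodel \<Rightarrow> 'n set \<Rightarrow> 'n set \<Rightarrow> 'n set \<Rightarrow> bool" where
  "clus2 Q X Y Z \<longleftrightarrow> card Y \<ge> 2 \<and> \<not> (\<exists>s. s \<noteq> {} \<and> s \<subset> Y \<and> affects Q X s Z {})"

definition clus3 :: "('n, 'a) cmodel \<Rightarrow> 'n set \<Rightarrow> 'n set \<Rightarrow> 'n set \<Rightarrow> bool" where
  "clus3 Q X Y Z \<longleftrightarrow> card Z \<ge> 1 \<and> \<not> (\<exists>s. s \<subset> Z \<and> affects Q X Y s {})"

abbreviation "irred1 Q X Y Z \<equiv> \<not> red1 Q X Y Z"
abbreviation "irred2 Q X Y Z \<equiv> \<not> red2 Q X Y Z"
abbreviation "irred3 Q X Y Z \<equiv> \<not> red3 Q X Y Z"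

end

theory Submission
  imports Defs
begin

(* For the first and third argument, clustering says that the complement of the reducing set
   has no effect either, and the two equalities of interventional distributions chain to
   contradict the affects relation. For the second argument, clustering equates the two
   distributions of the complement of s in Y, and the failure of the conditional relation provides a
   common version of the conditional probabilities of s given that complement. Integrating the one
   against the other equates the two distributions of Y. *)

text \<open>Integrating the conditional expectation over an event of its own sigma-algebra returns
  the joint probability, and a change of variables moves this integral to the value space of
  \<open>W\<close>. The right side depends on \<open>N\<close> only through the law of
  \<open>W\<close> and the version \<open>f\<close>, so two distributions can be compared by
  comparing these two data.\<close>

lemma measure_event_Int_event:
  assumes "prob_space N" and N: "sets N = sets (vals Q S)" and "W \<subseteq> S" "Y \<subseteq> S"
    and B: "B \<in> sets (vals Q Y)" and A: "A \<in> sets (vals Q W)"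
    and f: "is_cond_prob Q N Y B W f"
  shows "measure N (event N Y B \<inter> event N W A) =
    (\<integral>w. indicator A w * f w \<partial>distr N (vals Q W) (\<lambda>\<omega>. restrict \<omega> W))"
proof -
  interpret prob_space N by fact
  interpret finite_measure_subalgebra N "gen_by Q N W"
    using subalgebra_gen_by[OF N \<open>W \<subseteq> S\<close>] by unfold_locales
  have [measurable]: "(\<lambda>\<omega>. restrict \<omega> W) \<in> N \<rightarrow>\<^sub>M vals Q W"
    by (rule measurable_restrict_vals[OF N \<open>W \<subseteq> S\<close>])
  have [measurable]: "f \<in> borel_measurable (vals Q W)" "A \<in> sets (vals Q W)"
    and AE: "AE \<omega> in N. real_cond_exp N (gen_by Q N W) (indicator (event N Y B)) \<omega> = f (restrict \<omega> W)"
    using f A by (auto simp: is_cond_prob_def)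
  have [measurable]: "event N W A \<in> sets N" by (rule event_sets[OF N \<open>W \<subseteq> S\<close> A])
  have "measure N (event N Y B \<inter> event N W A) =
    (\<integral>\<omega>. indicator (event N W A) \<omega> * real_cond_exp N (gen_by Q N W) (indicator (event N Y B)) \<omega> \<partial>N)"
    using cond_exp_event[OF assms(1-6)] by (simp add: set_lebesgue_integral_def)
  also have "\<dots> = (\<integral>\<omega>. indicator A (restrict \<omega> W) * f (restrict \<omega> W) \<partial>N)"
  proof (rule integral_cong_AE)
    show "AE \<omega> in N. indicator (event N W A) \<omega> * real_cond_exp N (gen_by Q N W) (indicator (event N Y B)) \<omega>
      = indicator A (restrict \<omega> W) * f (restrict \<omega> W)"
      \<comment> \<open>On the space of \<open>N\<close>, lying in \<open>event N W A\<close> means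
        exactly that the restriction to \<open>W\<close> lies in \<open>A\<close>, so the indicators
        agree pointwise; only the factor \<open>f\<close> is matched almost everywhere.\<close>
      using AE AE_space by eventually_elim (auto simp: event_def indicator_def)
  qed measurable
  also have "\<dots> = (\<integral>w. indicator A w * f w \<partial>distr N (vals Q W) (\<lambda>\<omega>. restrict \<omega> W))"
    by (rule integral_distr[symmetric]) measurable
  finally show ?thesis .
qed

text \<open>A law on finitely many coordinates is determined by its values on boxes. The mass of a
  box is the integral, over its \<open>t\<close>-side, of a conditional probability of its
  \<open>s\<close>-side against the law of \<open>t\<close>; both ingredients agree for
  \<open>M\<close> and \<open>N\<close>. The versions may depend on \<open>B\<close>, since each box
  is treated separately.\<close>

lemma distr_eq_if_cond_eq:
  assumes M: "prob_space M" "sets M = sets (vals Q S)" and N: "prob_space N" "sets N = sets (vals Q S)"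
    and S: "s \<subseteq> S" "t \<subseteq> S" and fin: "finite s" "finite t"
    and t: "distr M (vals Q t) (\<lambda>\<omega>. restrict \<omega> t) = distr N (vals Q t) (\<lambda>\<omega>. restrict \<omega> t)"
    and cond: "\<And>B. B \<in> sets (vals Q s) \<Longrightarrow> \<exists>f g. is_cond_prob Q M s B t f \<and> is_cond_prob Q N s B t g \<and>
      (\<forall>w\<in>space (vals Q t). f w = g w)"
  shows "distr M (vals Q (s \<union> t)) (\<lambda>\<omega>. restrict \<omega> (s \<union> t)) =
    distr N (vals Q (s \<union> t)) (\<lambda>\<omega>. restrict \<omega> (s \<union> t))"
proof -
  interpret M: prob_space M by fact
  interpret N: prob_space N by fact
  have U: "s \<union> t \<subseteq> S" using S by auto
  let ?r = "\<lambda>\<omega>. restrict \<omega> (s \<union> t)"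
  note mM = measurable_restrict_vals[OF M(2) U] and mN = measurable_restrict_vals[OF N(2) U]
  interpret D: prob_space "distr M (vals Q (s \<union> t)) ?r" by (rule M.prob_space_distr[OF mM])
  \<comment> \<open>Boxes are stable under intersection and generate the product sigma-algebra. The
    exhausting sequence is constantly the whole space, which has finite mass because
    \<open>D\<close> is a probability space.\<close>
  show ?thesis
  proof (rule measure_eqI_PiM_finite[where I = "s \<union> t" and M = "val_space Q" and A = "\<lambda>_. \<Pi>\<^sub>E i\<in>s \<union> t. space (val_space Q i)"])
    show "finite (s \<union> t)" using fin by simp
    show "emeasure (distr M (vals Q (s \<union> t)) ?r) (Pi\<^sub>E (s \<union> t) A) = emeasure (distr N (vals Q (s \<union> t)) ?r) (Pi\<^sub>E (s \<union> t) A)"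
      if "\<And>i. i \<in> s \<union> t \<Longrightarrow> A i \<in> sets (val_space Q i)" for A
    proof -
      have sets: "Pi\<^sub>E J A \<in> sets (vals Q J)" if "J \<subseteq> s \<union> t" for J
        unfolding vals_def using that \<open>\<And>i. i \<in> s \<union> t \<Longrightarrow> A i \<in> sets (val_space Q i)\<close> fin
        by (intro sets_PiM_I_finite) (auto intro: finite_subset[of J "s \<union> t"])
      \<comment> \<open>Splitting a box into its \<open>s\<close>-side and \<open>t\<close>-side
        gives the intersection of events on which conditioning on \<open>t\<close> acts.\<close>
      have ev: "?r -` Pi\<^sub>E (s \<union> t) A \<inter> space K = event K s (Pi\<^sub>E s A) \<inter> event K t (Pi\<^sub>E t A)" for K
        by (auto simp: event_def PiE_iff)
      obtain f g where f: "is_cond_prob Q M s (Pi\<^sub>E s A) t f" and g: "is_cond_prob Q N s (Pi\<^sub>E s A) t g"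
        and fg: "\<forall>w\<in>space (vals Q t). f w = g w"
        using cond[OF sets] by auto
      have "measure M (event M s (Pi\<^sub>E s A) \<inter> event M t (Pi\<^sub>E t A)) =
        (\<integral>w. indicator (Pi\<^sub>E t A) w * f w \<partial>distr M (vals Q t) (\<lambda>\<omega>. restrict \<omega> t))"
        by (intro measure_event_Int_event[OF M S(2,1) _ _ f] sets) auto
      \<comment> \<open>Here the measures change along with the integrands: the laws of
        \<open>t\<close> coincide by \<open>t\<close>, and the versions agree at every point of the
        value space.\<close>
      also have "\<dots> = (\<integral>w. indicator (Pi\<^sub>E t A) w * g w \<partial>distr N (vals Q t) (\<lambda>\<omega>. restrict \<omega> t))"
        unfolding t by (rule Bochner_Integration.integral_cong) (use fg in auto)
      also have "\<dots> = measure N (event N s (Pi\<^sub>E s A) \<inter> event N t (Pi\<^sub>E t A))"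
        by (intro measure_event_Int_event[OF N S(2,1) _ _ g, symmetric] sets) auto
      finally show ?thesis
        by (simp add: emeasure_distr[OF mM] emeasure_distr[OF mN] sets ev M.emeasure_eq_measure N.emeasure_eq_measure)
    qed
    show "range (\<lambda>_::nat. \<Pi>\<^sub>E i\<in>s \<union> t. space (val_space Q i)) \<subseteq> prod_algebra (s \<union> t) (val_space Q)"
      using fin by (auto intro!: prod_algebraI_finite)
    show "emeasure (distr M (vals Q (s \<union> t)) ?r) (\<Pi>\<^sub>E i\<in>s \<union> t. space (val_space Q i)) \<noteq> \<infinity>"
      by (simp add: D.emeasure_eq_measure)
  qed (auto simp: vals_def space_PiM)
qed

context causal_model
begin

lemma affectsE:
  assumes "affects Q X Y Z {}" "X \<subseteq> observed Q" "Y \<subseteq> observed Q" "Z \<subseteq> observed Q"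
  obtains v where "v \<in> space (vals Q (X \<union> Z))"
    "distr (do_cond Q (X \<union> Z) v) (vals Q Y) (\<lambda>\<omega>. restrict \<omega> Y) \<noteq>
      distr (do_cond Q Z (restrict v Z)) (vals Q Y) (\<lambda>\<omega>. restrict \<omega> Y)"
  using assms(1) unfolding affects_no_cond[OF assms(2-4)] by (elim bexE) (rule that)

lemma not_affectsD:
  assumes "\<not> affects Q X Y Z {}" "X \<subseteq> observed Q" "Y \<subseteq> observed Q" "Z \<subseteq> observed Q"
    and "v \<in> space (vals Q (X \<union> Z))"
  shows "distr (do_cond Q (X \<union> Z) v) (vals Q Y) (\<lambda>\<omega>. restrict \<omega> Y) =
    distr (do_cond Q Z (restrict v Z)) (vals Q Y) (\<lambda>\<omega>. restrict \<omega> Y)"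
  using assms(1,5) unfolding affects_no_cond[OF assms(2-4)] by blast

text \<open>Intervening on \<open>X \<union> Z\<close> gives \<open>Y\<close> the same law as
  intervening on \<open>(X - s) \<union> Z\<close>, by the reducing set \<open>s\<close>, and then
  the same law as intervening on \<open>Z\<close>, by clustering applied to
  \<open>X - s\<close>.\<close>

lemma clus1_imp_irred1:
  assumes "X \<subseteq> observed Q" "Y \<subseteq> observed Q" "Z \<subseteq> observed Q" "affects Q X Y Z {}"
    and "clus1 Q X Y Z"
  shows "irred1 Q X Y Z"
proof
  let ?law = "\<lambda>K. distr K (vals Q Y) (\<lambda>\<omega>. restrict \<omega> Y)"
  assume "red1 Q X Y Z"
  then obtain s where s: "s \<noteq> {}" "s \<subset> X" "\<not> affects Q s Y ((X - s) \<union> Z) {}"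
    unfolding red1_def by (elim exE conjE)
  have c: "\<not> affects Q (X - s) Y Z {}"
  proof -
    \<comment> \<open>Properness of \<open>s\<close> makes the complement non-empty, and
      non-emptiness of \<open>s\<close> makes it proper, so clustering applies to it.\<close>
    have "X - s \<noteq> {}" "X - s \<subset> X" using s(1,2) by auto
    then show ?thesis using assms(5) unfolding clus1_def by metis
  qed
  have U: "s \<union> ((X - s) \<union> Z) = X \<union> Z" using s by auto
  have Z: "restrict (restrict v ((X - s) \<union> Z)) Z = restrict v Z" for v :: "'n \<Rightarrow> 'a"
    by (auto simp: restrict_def)
  have obs: "s \<subseteq> observed Q" "X - s \<subseteq> observed Q" "(X - s) \<union> Z \<subseteq> observed Q" using assms(1-3) s(2) by auto
  obtain v where v: "v \<in> space (vals Q (X \<union> Z))"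
    and ne: "?law (do_cond Q (X \<union> Z) v) \<noteq> ?law (do_cond Q Z (restrict v Z))"
    by (rule affectsE[OF assms(4) assms(1-3)])
  have "?law (do_cond Q (X \<union> Z) v) = ?law (do_cond Q ((X - s) \<union> Z) (restrict v ((X - s) \<union> Z)))"
    using not_affectsD[OF s(3) obs(1) assms(2) obs(3), unfolded U] v .
  also have "\<dots> = ?law (do_cond Q Z (restrict v Z))"
    by (rule not_affectsD[OF c obs(2) assms(2,3), of "restrict v ((X - s) \<union> Z)", unfolded Z],
        rule restrict_vals[OF v]) (use s(2) in auto)
  finally show False using ne by simp
qed

text \<open>The law of \<open>Y\<close> is assembled from the law of \<open>Y - s\<close>, which
  clustering fixes, and the conditional probabilities of \<open>s\<close> given
  \<open>Y - s\<close>, which the failed conditional relation fixes.\<close>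

lemma clus2_imp_irred2:
  assumes "X \<subseteq> observed Q" "Y \<subseteq> observed Q" "Z \<subseteq> observed Q" "affects Q X Y Z {}"
    and "clus2 Q X Y Z"
  shows "irred2 Q X Y Z"
proof
  assume "red2 Q X Y Z"
  then obtain s where s: "s \<noteq> {}" "s \<subset> Y" "\<not> affects Q X s Z (Y - s)"
    unfolding red2_def by (elim exE conjE)
  have c: "\<not> affects Q X (Y - s) Z {}"
  proof -
    have "Y - s \<noteq> {}" "Y - s \<subset> Y" using s(1,2) by auto
    then show ?thesis using assms(5) unfolding clus2_def by metis
  qed
  have U: "s \<union> (Y - s) = Y" using s by auto
  have XZ: "X \<union> Z \<subseteq> observed Q" and Y: "s \<subseteq> observed Q" "Y - s \<subseteq> observed Q" using assms(1-3) s(2) by auto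
  have fin: "finite s" "finite (Y - s)" using Y finite_observed by (auto intro: finite_subset)
  obtain v where v: "v \<in> space (vals Q (X \<union> Z))"
    and ne: "distr (do_cond Q (X \<union> Z) v) (vals Q Y) (\<lambda>\<omega>. restrict \<omega> Y) \<noteq>
      distr (do_cond Q Z (restrict v Z)) (vals Q Y) (\<lambda>\<omega>. restrict \<omega> Y)"
    by (rule affectsE[OF assms(4) assms(1-3)])
  have vZ: "restrict v Z \<in> space (vals Q Z)" using restrict_vals[OF v] by simp
  have "distr (do_cond Q (X \<union> Z) v) (vals Q (s \<union> (Y - s))) (\<lambda>\<omega>. restrict \<omega> (s \<union> (Y - s))) =
      distr (do_cond Q Z (restrict v Z)) (vals Q (s \<union> (Y - s))) (\<lambda>\<omega>. restrict \<omega> (s \<union> (Y - s)))"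
  proof (rule distr_eq_if_cond_eq[OF do_cond_sets[OF XZ v] do_cond_sets[OF assms(3) vZ] Y fin])
    show "distr (do_cond Q (X \<union> Z) v) (vals Q (Y - s)) (\<lambda>\<omega>. restrict \<omega> (Y - s)) =
      distr (do_cond Q Z (restrict v Z)) (vals Q (Y - s)) (\<lambda>\<omega>. restrict \<omega> (Y - s))"
      by (rule not_affectsD[OF c assms(1) Y(2) assms(3) v])
  next
    fix B assume B: "B \<in> sets (vals Q s)"
    show "\<exists>f g. is_cond_prob Q (do_cond Q (X \<union> Z) v) s B (Y - s) f \<and>
      is_cond_prob Q (do_cond Q Z (restrict v Z)) s B (Y - s) g \<and> (\<forall>w\<in>space (vals Q (Y - s)). f w = g w)"
    \<comment> \<open>\<open>affects\<close> demands that all pairs of versions differ somewhere, so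
      its failure at \<open>v\<close> and \<open>B\<close> is precisely the existence of a pair
      agreeing everywhere.\<close>
    proof (rule ccontr)
      assume neg: "\<not> ?thesis"
      have "affects Q X s Z (Y - s)" unfolding affects_def
        by (rule bexI[OF _ v], rule bexI[OF _ B]) (use neg in simp)
      with s(3) show False ..
    qed
  qed
  then show False using ne unfolding U by simp
qed

text \<open>The law of \<open>Y\<close> is carried from \<open>X \<union> Z\<close> to
  \<open>X \<union> (Z - s)\<close>, then to \<open>Z - s\<close>, and back up to \<open>Z\<close>.
  The two failed relations of \<open>s\<close> give the outer links, clustering the middle
  one.\<close>

lemma clus3_imp_irred3:
  assumes "X \<subseteq> observed Q" "Y \<subseteq> observed Q" "Z \<subseteq> observed Q" "affects Q X Y Z {}"
    and "clus3 Q X Y Z"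
  shows "irred3 Q X Y Z"
proof
  let ?law = "\<lambda>K. distr K (vals Q Y) (\<lambda>\<omega>. restrict \<omega> Y)"
  assume "red3 Q X Y Z"
  then obtain s where s: "s \<noteq> {}" "s \<subseteq> Z" "\<not> affects Q s Y (X \<union> (Z - s)) {}" "\<not> affects Q s Y (Z - s) {}"
   
    unfolding red3_def by (elim exE conjE)
  have c: "\<not> affects Q X Y (Z - s) {}"
  proof -
    \<comment> \<open>The case \<open>s = Z\<close> leaves the empty set here, which
      \<open>clus3\<close> admits among its proper subsets.\<close>
    have "Z - s \<subset> Z" using s(1,2) by auto
    then show ?thesis using assms(5) unfolding clus3_def by metis
  qed
  have U: "s \<union> (X \<union> (Z - s)) = X \<union> Z" "s \<union> (Z - s) = Z" using s by auto
  have Z: "restrict (restrict v (X \<union> (Z - s))) (Z - s) = restrict (restrict v Z) (Z - s)" for v :: "'n \<Rightarrow> 'a"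
    by (auto simp: restrict_def)
  have obs: "s \<subseteq> observed Q" "X \<union> (Z - s) \<subseteq> observed Q" "Z - s \<subseteq> observed Q" using assms(1-3) s(2) by auto
  obtain v where v: "v \<in> space (vals Q (X \<union> Z))"
    and ne: "?law (do_cond Q (X \<union> Z) v) \<noteq> ?law (do_cond Q Z (restrict v Z))"
    by (rule affectsE[OF assms(4) assms(1-3)])
  have "?law (do_cond Q (X \<union> Z) v) = ?law (do_cond Q (X \<union> (Z - s)) (restrict v (X \<union> (Z - s))))"
    using not_affectsD[OF s(3) obs(1) assms(2) obs(2), unfolded U] v .
  also have "\<dots> = ?law (do_cond Q (Z - s) (restrict (restrict v (X \<union> (Z - s))) (Z - s)))"
    by (rule not_affectsD[OF c assms(1,2) obs(3)], rule restrict_vals[OF v]) auto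
  also have "\<dots> = ?law (do_cond Q (Z - s) (restrict (restrict v Z) (Z - s)))" unfolding Z ..
  \<comment> \<open>The second failed relation of \<open>s\<close> is read backwards, putting the
    intervention on \<open>s\<close> back in.\<close>
  also have "\<dots> = ?law (do_cond Q Z (restrict v Z))"
    by (rule not_affectsD[OF s(4) obs(1) assms(2) obs(3), unfolded U, symmetric], rule restrict_vals[OF v]) simp
  finally show False using ne by simp
qed

end

theorem theorem4p11:
  fixes Q :: "('n, 'a) cmodel" and X Y Z :: "'n set"
  assumes "causal_model Q"
    and "X \<subseteq> observed Q" and "Y \<subseteq> observed Q" and "Z \<subseteq> observed Q"
    and "X \<inter> Y = {}" and "X \<inter> Z = {}" and "Y \<inter> Z = {}"
    and "X \<noteq> {}" and "Y \<noteq> {}"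
    and "affects Q X Y Z {}"
  shows "(clus1 Q X Y Z \<longrightarrow> irred1 Q X Y Z) \<and>
         (clus2 Q X Y Z \<longrightarrow> irred2 Q X Y Z) \<and>
         (clus3 Q X Y Z \<longrightarrow> irred3 Q X Y Z)"
proof -
  interpret causal_model Q by fact
  show ?thesis
    using clus1_imp_irred1[OF assms(2-4,10)] clus2_imp_irred2[OF assms(2-4,10)]
      clus3_imp_irred3[OF assms(2-4,10)] by simp
qed

end
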